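(* Let $ABCD$ be an arbitrary quadrilateral. Diagonals $AC$ and $BD$ meet at $P$. Let $O_a$, $O_b$, $O_c$, and $O_d$ be the circumcenters of the triangles $BCD$, $CDA$, $DAB$, and $ABC$, respectively. Let $M$ and $N$ be the midpoints of segments $O_aO_c$ and $O_bO_d$, respectively. The perpendicular line from $P$ to $MN$ meets lines $AB$ and $CD$ at $Q$ and $R$, respectively. Then $P$ is the midpoint of $QR$.
   Context: The setting is the Euclidean plane. *)

theory Defs
  imports "HOL-Analysis.Analysis"
begin

text \<open>
  A quadrilateral is given by its vertices in cyclic order. It need be neither convex nor simple;
  the only requirement is that no three vertices are collinear (in particular, the vertices are
  distinct), so that each three of them form a triangle. Accordingly, diagonals and sides are
  extended to full lines, written as affine hulls of two points.
\<close>

definition quadrilateral :: "real^2 \<Rightarrow> real^2 \<Rightarrow> real^2 \<Rightarrow> real^2 \<Rightarrow> bool" where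
  "quadrilateral A B C D \<longleftrightarrow>
     \<not> collinear {A, B, C} \<and> \<not> collinear {B, C, D} \<and>
     \<not> collinear {C, D, A} \<and> \<not> collinear {D, A, B}"

definition is_circumcenter :: "real^2 \<Rightarrow> real^2 \<Rightarrow> real^2 \<Rightarrow> real^2 \<Rightarrow> bool" where
  "is_circumcenter X A B C \<longleftrightarrow>
     \<not> collinear {A, B, C} \<and> dist X A = dist X B \<and> dist X B = dist X C"

text \<open>
  The line through \<open>P\<close> perpendicular to the line \<open>U V\<close>; meaningful only if \<open>U \<noteq> V\<close>
  (for \<open>U = V\<close> the set is the whole plane).
\<close>

definition perpendicular_line :: "real^2 \<Rightarrow> real^2 \<Rightarrow> real^2 \<Rightarrow> (real^2) set" where
  "perpendicular_line P U V = {X. orthogonal (X - P) (V - U)}"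

end

theory Submission
  imports Defs
begin

text \<open>
  Take \<open>P\<close> as origin and the vectors \<open>u\<close> from \<open>P\<close> to \<open>A\<close> and \<open>v\<close> from \<open>P\<close> to \<open>B\<close> as a basis, so that
  \<open>A = u\<close>, \<open>B = v\<close>, \<open>C = c u\<close>, \<open>D = d v\<close>. In coordinates \<open>(x, y)\<close> the lines \<open>AB\<close> and \<open>CD\<close> are
  \<open>\<alpha> = 1\<close> and \<open>\<gamma> = 1\<close> for the linear forms \<open>\<alpha> = x + y\<close> and \<open>\<gamma> = x/c + y/d\<close>.

  The key fact is that the inner product with \<open>M - N\<close> is a multiple of \<open>\<alpha> + \<gamma>\<close>. Indeed, the
  power of \<open>P\<close> with respect to each of the four circles is given by the diagonal that is a chord
  of it: \<open>d |v|\<^sup>2\<close> for the two circles through \<open>B, D\<close>, and \<open>c |u|\<^sup>2\<close> for the two through \<open>A, C\<close>. This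
  determines the components of all circumcenters along both diagonals, and the components of
  \<open>M - N\<close> along \<open>u\<close> and \<open>v\<close> come out as \<open>1 + 1/c\<close> and \<open>1 + 1/d\<close>, up to the common factor
  \<open>(d |v|\<^sup>2 - c |u|\<^sup>2) / 4\<close> (lemma \<open>circumcenter_midpoints_component\<close>). The factor is nonzero
  because \<open>M \<noteq> N\<close>.

  Hence the perpendicular through \<open>P\<close> is the line \<open>\<alpha> + \<gamma> = 0\<close>. On it, \<open>Q\<close> has
  \<open>(\<alpha>, \<gamma>) = (1, -1)\<close> and \<open>R\<close> has \<open>(\<alpha>, \<gamma>) = (-1, 1)\<close>, so both forms vanish at \<open>Q + R\<close>. If they
  are independent, then \<open>Q + R = 0\<close>, as claimed. If they are proportional, their values at \<open>Q\<close>
  force \<open>\<gamma> = -\<alpha>\<close>, which means that \<open>M - N\<close> is orthogonal to both diagonals; in the plane this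
  contradicts \<open>M \<noteq> N\<close>.
\<close>

lemma affine_hull_2_scale:
  fixes A C P :: "'a::real_vector"
  assumes "P \<in> affine hull {A, C}" and "P \<noteq> A"
  obtains c where "C - P = c *\<^sub>R (A - P)"
proof -
  obtain s t where P: "P = s *\<^sub>R A + t *\<^sub>R C" and "s + t = 1"
    using assms(1) by (auto simp: affine_hull_2)
  then have s: "s = 1 - t" by simp
  have AP: "A - P = - t *\<^sub>R (C - A)" and CP: "C - P = (1 - t) *\<^sub>R (C - A)"
    unfolding P s by (simp_all add: algebra_simps)
  have "t \<noteq> 0" using AP assms(2) by auto
  then have "C - P = (- (1 - t) / t) *\<^sub>R (A - P)"
    unfolding AP CP by (simp flip: scaleR_minus_left)
  then show thesis by (rule that)
qed

lemma not_collinear_not_in_affine_hull: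
  fixes X Y Z :: "'a::euclidean_space"
  assumes "\<not> collinear {X, Y, Z}"
  shows "X \<notin> affine hull {Y, Z}"
proof
  assume "X \<in> affine hull {Y, Z}"
  then have "{X, Y, Z} \<subseteq> affine hull {Y, Z}"
    by (auto simp: hull_inc)
  then show False
    using assms collinear_affine_hull_collinear[of "{Y, Z}"] collinear_2 collinear_subset
    by blast
qed

text \<open>
  Both sides of \<open>2 O' \<bullet> U - |U|\<^sup>2 = k |S|\<^sup>2\<close> are the power of the origin with respect to the circle
  around \<open>O'\<close>: on the left it is computed from the point \<open>U\<close> of the circle, as
  \<open>|O'|\<^sup>2 - |O' - U|\<^sup>2\<close>, on the right from the secant through the origin that meets the circle in
  \<open>S\<close> and \<open>k S\<close>.
\<close>
lemma circle_center_component: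
  fixes O' S U :: "'a::real_inner"
  assumes S: "dist O' S = dist O' (k *\<^sub>R S)" and U: "dist O' U = dist O' S" and "k \<noteq> 1"
  shows "2 * (O' \<bullet> U) = U \<bullet> U + k * (S \<bullet> S)"
proof -
  have "(O' - S) \<bullet> (O' - S) = (O' - k *\<^sub>R S) \<bullet> (O' - k *\<^sub>R S)"
    using S by (simp add: dist_norm norm_eq)
  then have "(k - 1) * (2 * (O' \<bullet> S)) = (k - 1) * ((1 + k) * (S \<bullet> S))"
    by (simp add: algebra_simps inner_commute)
  then have OS: "2 * (O' \<bullet> S) = (1 + k) * (S \<bullet> S)"
    using \<open>k \<noteq> 1\<close> by simp
  have "(O' - U) \<bullet> (O' - U) = (O' - S) \<bullet> (O' - S)"
    using U by (simp add: dist_norm norm_eq)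
  then show ?thesis
    using OS by (simp add: algebra_simps inner_commute)
qed

text \<open>
  The circles around \<open>Oa\<close> and \<open>Oc\<close> have the chord \<open>BD\<close> in common and pass through \<open>C\<close> and \<open>A\<close>,
  respectively, which gives the component of \<open>M\<close>; the component of \<open>N\<close> is that of the midpoint of
  \<open>AC\<close>, since \<open>Ob\<close> and \<open>Od\<close> lie on the perpendicular bisector of \<open>AC\<close>. The situation is invariant
  under exchanging the two diagonals, so the lemma also gives the component along \<open>PB\<close>.
\<close>
lemma circumcenter_midpoints_component:
  fixes A B C D P :: "'a::real_inner"
  assumes C: "C - P = c *\<^sub>R (A - P)" and D: "D - P = d *\<^sub>R (B - P)"
    and c: "c \<noteq> 0" "c \<noteq> 1" and d: "d \<noteq> 1"
    and Oa: "dist Oa B = dist Oa D" "dist Oa C = dist Oa B"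
    and Oc: "dist Oc B = dist Oc D" "dist Oc A = dist Oc B"
    and Ob: "dist Ob A = dist Ob C" and Od: "dist Od A = dist Od C"
  shows "4 * ((midpoint Oa Oc - midpoint Ob Od) \<bullet> (A - P))
    = (1 + 1 / c) * (d * ((B - P) \<bullet> (B - P)) - c * ((A - P) \<bullet> (A - P)))"
proof -
  define u v where "u = A - P" and "v = B - P"
  have shift: "dist X Y = dist X Z \<Longrightarrow> dist (X - P) (Y - P) = dist (X - P) (Z - P)"
    for X Y Z :: 'a
    by (simp add: dist_norm)
  note shifted = Oa[THEN shift] Oc[THEN shift] Ob[THEN shift] Od[THEN shift]
  note eqs = shifted[unfolded C D, folded u_def v_def]
  have a: "2 * ((Oa - P) \<bullet> (c *\<^sub>R u)) = (c *\<^sub>R u) \<bullet> (c *\<^sub>R u) + d * (v \<bullet> v)"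
    by (rule circle_center_component) (use eqs d in auto)
  have a': "2 * ((Oa - P) \<bullet> u) = c * (u \<bullet> u) + d * (v \<bullet> v) / c"
    using a c by (simp add: field_simps)
  have c': "2 * ((Oc - P) \<bullet> u) = u \<bullet> u + d * (v \<bullet> v)"
    by (rule circle_center_component) (use eqs d in auto)
  have b': "2 * ((Ob - P) \<bullet> u) = u \<bullet> u + c * (u \<bullet> u)"
    by (rule circle_center_component) (use eqs c in auto)
  have d': "2 * ((Od - P) \<bullet> u) = u \<bullet> u + c * (u \<bullet> u)"
    by (rule circle_center_component) (use eqs c in auto)
  have "4 * ((midpoint Oa Oc - midpoint Ob Od) \<bullet> u)
    = 2 * ((Oa - P) \<bullet> u) + 2 * ((Oc - P) \<bullet> u) - 2 * ((Ob - P) \<bullet> u) - 2 * ((Od - P) \<bullet> u)"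
    by (simp add: midpoint_def algebra_simps)
  also have "\<dots> = (1 + 1 / c) * (d * (v \<bullet> v) - c * (u \<bullet> u))"
    unfolding a' b' c' d' using c by (simp add: field_simps)
  finally show ?thesis unfolding u_def v_def .
qed

text \<open>
  In the notation of the introduction, with \<open>P\<close> as origin: \<open>(x, y)\<close> is \<open>Q\<close> and \<open>(x' c, y' d)\<close> is
  \<open>R\<close>, and the last two hypotheses say \<open>\<alpha> + \<gamma> = 0\<close> at these points. The excluded case
  \<open>c = d = -1\<close> is that of a parallelogram.
\<close>
lemma antipodal_intersections:
  fixes c d x y x' y' :: real
  assumes "c \<noteq> 0" "d \<noteq> 0" and "\<not> (c = -1 \<and> d = -1)"
    and xy: "x + y = 1" and xy': "x' + y' = 1"
    and Q: "x * (1 + 1 / c) + y * (1 + 1 / d) = 0"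
    and R: "x' * c * (1 + 1 / c) + y' * d * (1 + 1 / d) = 0"
  shows "x + x' * c = 0 \<and> y + y' * d = 0"
proof -
  have Q': "x / c + y / d = -1"
    using Q xy by (simp add: algebra_simps)
  have R': "x' * c + y' * d = -1"
  proof -
    have "x' * c * (1 + 1 / c) = x' * c + x'" "y' * d * (1 + 1 / d) = y' * d + y'"
      using assms(1,2) by (simp_all add: distrib_left)
    then show ?thesis using R xy' by simp
  qed
  have "c \<noteq> d"
  proof
    assume "c = d"
    then have "1 / c = -1"
      using Q' xy by (simp flip: add_divide_distrib)
    then have "c = -1"
      using assms(1) by (simp add: field_simps)
    then show False
      using \<open>c = d\<close> assms(3) by simp
  qed
  define p q where "p = x + x' * c" and "q = y + y' * d"
  have "p + q = 0"
    using xy R' by (simp add: p_def q_def)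
  moreover have "p / c + q / d = 0"
    using Q' xy' assms(1,2) by (simp add: p_def q_def add_divide_distrib)
  ultimately have "q = - p" "p / c + q / d = 0"
    by auto
  then have "p * (d - c) = 0"
    using assms(1,2) by (simp add: field_simps)
  then show ?thesis
    using \<open>c \<noteq> d\<close> \<open>p + q = 0\<close> by (simp add: p_def q_def)
qed

theorem theorem3:
  fixes A B C D P Oa Ob Oc Od M N Q R :: "real^2"
  assumes "quadrilateral A B C D"
    and "P \<in> affine hull {A, C} \<inter> affine hull {B, D}"
    and "is_circumcenter Oa B C D"
    and "is_circumcenter Ob C D A"
    and "is_circumcenter Oc D A B"
    and "is_circumcenter Od A B C"
    and "M = midpoint Oa Oc"
    and "N = midpoint Ob Od"
    and "M \<noteq> N"
    and "Q \<in> perpendicular_line P M N \<inter> affine hull {A, B}"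
    and "R \<in> perpendicular_line P M N \<inter> affine hull {C, D}"
  shows "P = midpoint Q R"
proof -
  have ABC: "\<not> collinear {A, B, C}" and BCD: "\<not> collinear {B, C, D}"
    and CDA: "\<not> collinear {C, D, A}" and DAB: "\<not> collinear {D, A, B}"
    using assms(1) by (auto simp: quadrilateral_def)
  have "P \<noteq> A" "P \<noteq> B" "P \<noteq> C" "P \<noteq> D"
    using not_collinear_not_in_affine_hull[of A B D] not_collinear_not_in_affine_hull[of B A C]
      not_collinear_not_in_affine_hull[of C B D] not_collinear_not_in_affine_hull[of D A C]
      ABC BCD CDA DAB assms(2)
    by (auto simp: insert_commute)
  have "A \<noteq> C" "B \<noteq> D"
    using ABC BCD by (auto simp: insert_commute)
  define u v where "u = A - P" and "v = B - P"
  obtain c where "C - P = c *\<^sub>R (A - P)"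
    using affine_hull_2_scale[of P A C] assms(2) \<open>P \<noteq> A\<close> by auto
  note C = this[folded u_def]
  obtain d where "D - P = d *\<^sub>R (B - P)"
    using affine_hull_2_scale[of P B D] assms(2) \<open>P \<noteq> B\<close> by auto
  note D = this[folded v_def]
  have c: "c \<noteq> 0" "c \<noteq> 1" and d: "d \<noteq> 0" "d \<noteq> 1"
    using C D \<open>P \<noteq> C\<close> \<open>P \<noteq> D\<close> \<open>A \<noteq> C\<close> \<open>B \<noteq> D\<close> by (auto simp: u_def v_def)
  define w where "w = M - N"
  define K where "K = d * (v \<bullet> v) - c * (u \<bullet> u)"
  have wu: "4 * (w \<bullet> u) = (1 + 1 / c) * K"
    unfolding w_def K_def assms(7,8) u_def v_def
    by (rule circumcenter_midpoints_component[of C P c A D d B])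
      (use C D c d assms(3-6) in \<open>auto simp: u_def v_def is_circumcenter_def\<close>)
  have "4 * ((midpoint Ob Od - midpoint Oa Oc) \<bullet> v) = (1 + 1 / d) * (c * (u \<bullet> u) - d * (v \<bullet> v))"
    unfolding u_def v_def
    by (rule circumcenter_midpoints_component[of D P d B C c A])
      (use C D c d assms(3-6) in \<open>auto simp: u_def v_def is_circumcenter_def\<close>)
  then have wv: "4 * (w \<bullet> v) = (1 + 1 / d) * K"
    unfolding w_def K_def assms(7,8) by (simp add: algebra_simps)
  \<comment> \<open>Otherwise \<open>A\<close>, \<open>B\<close>, \<open>C\<close> would lie on the line through \<open>P\<close> orthogonal to \<open>w\<close>.\<close>
  have not_both: "\<not> (w \<bullet> u = 0 \<and> w \<bullet> v = 0)"
  proof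
    assume 0: "w \<bullet> u = 0 \<and> w \<bullet> v = 0"
    have "w \<bullet> (C - P) = 0"
      using 0 by (simp add: C)
    then have "{A, B, C} \<subseteq> {X. w \<bullet> X = w \<bullet> P}"
      using 0 by (auto simp: u_def v_def inner_diff_right)
    moreover have "collinear {X. w \<bullet> X = w \<bullet> P}"
      using assms(9) by (simp add: collinear_aff_dim w_def)
    ultimately show False
      using ABC collinear_subset by blast
  qed
  then have "K \<noteq> 0" and "\<not> (c = -1 \<and> d = -1)"
    using wu wv by auto
  obtain x y where Q: "Q = x *\<^sub>R A + y *\<^sub>R B" and xy: "x + y = 1"
    using assms(10) by (auto simp: affine_hull_2)
  obtain x' y' where R: "R = x' *\<^sub>R C + y' *\<^sub>R D" and xy': "x' + y' = 1"
    using assms(11) by (auto simp: affine_hull_2)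
  have x: "x = 1 - y" and x': "x' = 1 - y'"
    using xy xy' by simp_all
  have QP: "Q - P = x *\<^sub>R u + y *\<^sub>R v"
    unfolding Q u_def v_def x by (simp add: algebra_simps)
  have "R - P = x' *\<^sub>R (C - P) + y' *\<^sub>R (D - P)"
    unfolding R x' by (simp add: algebra_simps)
  then have RP: "R - P = (x' * c) *\<^sub>R u + (y' * d) *\<^sub>R v"
    by (simp add: C D)
  have perp: "s * (1 + 1 / c) + t * (1 + 1 / d) = 0"
    if "X \<in> perpendicular_line P M N" and X: "X - P = s *\<^sub>R u + t *\<^sub>R v" for X s t
  proof -
    have "w \<bullet> (X - P) = 0"
      using that(1)
      by (simp add: perpendicular_line_def orthogonal_def w_def inner_commute algebra_simps)
    then have "s * (4 * (w \<bullet> u)) + t * (4 * (w \<bullet> v)) = 0"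
      unfolding X by (simp add: inner_add_right)
    then have "K * (s * (1 + 1 / c) + t * (1 + 1 / d)) = 0"
      unfolding wu wv by (simp add: algebra_simps)
    then show ?thesis using \<open>K \<noteq> 0\<close> by simp
  qed
  have "x + x' * c = 0 \<and> y + y' * d = 0"
    using c(1) d(1) \<open>\<not> (c = -1 \<and> d = -1)\<close> xy xy'
    by (rule antipodal_intersections) (use perp QP RP assms(10,11) in blast)+
  moreover have "(Q - P) + (R - P) = (x + x' * c) *\<^sub>R u + (y + y' * d) *\<^sub>R v"
    unfolding QP RP by (simp add: algebra_simps)
  ultimately have "(Q - P) + (R - P) = 0" by simp
  then have "Q + R = 2 *\<^sub>R P"
    by (simp add: algebra_simps scaleR_2)
  then show ?thesis by (simp add: midpoint_def)
qed

end
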